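(* Let $n\ge4$ be even and let $D$, $S$, $\omega$, $\theta_k$, $x_j$ be as in the context. For $k=1,\dots,n-2$ define $v_k=(1,\omega^k,\omega^{2k},\dots,\omega^{(n-2)k})'$, $u_k=\frac{-1}{8\cos^2(\frac{\pi k}{n-1})}Sv_k$, and $q_k=(0,u_k',v_k')'\in\mathbb{C}^{2n-1}$. Then: (i) $Dq_k=\theta_kq_k$ for each $k$; (ii) the vectors $q_1,\dots,q_{n-2}$ are mutually orthogonal; (iii) $\langle x_j,q_k\rangle=0$ for all $j\in\{1,2\}$ and $k\in\{1,\dots,n-2\}$; (iv) $\langle\mathbf{1},q_k\rangle=0$ for all $k$.
   Context: $\mathbf{1}_p$ is the all-ones vector in $\mathbb{R}^p$, $\mathbf{1}=\mathbf{1}_{2n-1}$, $J_p=\mathbf{1}_p\mathbf{1}_p'$, $I_p$ the identity, $X'$ transpose; $\langle x,y\rangle=y^*x$ is the standard inner product on $\mathbb{C}^p$. $\mathrm{Circ}(a_1,\dots,a_p)$ is the circulant matrix with first row $(a_1,\dots,a_p)$, each subsequent row the previous one shifted cyclically one position to the right. $S=\mathrm{Circ}(1,3,\dots,3,1)$ (size $n-1$, $n-3$ entries equal to $3$), $T=\mathrm{Circ}(0,2,4,\dots,4,2)$ (size $n-1$, $n-4$ entries equal to $4$), and \[D=\begin{bmatrix}0&\mathbf{1}_{n-1}'&2\mathbf{1}_{n-1}'\\ \mathbf{1}_{n-1}&2(J_{n-1}-I_{n-1})&S\\ 2\mathbf{1}_{n-1}&S'&T\end{bmatrix}\] (the distance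 matrix of the gear graph on $2n-1$ vertices). $\omega=e^{2\pi i/(n-1)}$, $\theta_k=-8\cos^2(\frac{\pi k}{n-1})-2$. For $j=1,2$: $x_j=(\alpha_j,\beta_j\mathbf{1}_{n-1}',\mathbf{1}_{n-1}')'$ with $\alpha_j=\frac{15-5n-2(-1)^j\sqrt5\sqrt{n(2n-9)+12}}{3(n-1)}$ and $\beta_j=\frac{6-n-(-1)^j\sqrt5\sqrt{n(2n-9)+12}}{3(n-1)}$. *)

theory Defs
  imports Complex_Main "Jordan_Normal_Form.Matrix"
begin

definition ones :: "nat \<Rightarrow> complex vec" where
  "ones p = vec p (\<lambda>_. 1)"

definition J_mat :: "nat \<Rightarrow> complex mat" where
  "J_mat p = (mat_of_row (ones p))\<^sup>T * mat_of_row (ones p)"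

(* The list is the first row; row i is that row shifted i positions to the right,
   so entry (i, j), counted from 0, is the element at position j - i modulo p. *)
definition Circ :: "'a list \<Rightarrow> 'a mat" where
  "Circ a = mat (length a) (length a) (\<lambda>(i, j). a ! ((j + length a - i) mod length a))"

definition S_mat :: "nat \<Rightarrow> complex mat" where
  "S_mat n = Circ ([1] @ replicate (n - 3) 3 @ [1])"

definition T_mat :: "nat \<Rightarrow> complex mat" where
  "T_mat n = Circ ([0, 2] @ replicate (n - 4) 4 @ [2])"

definition D_mat :: "nat \<Rightarrow> complex mat" where
  "D_mat n =
    (let r = mat_of_row (ones (n - 1) @\<^sub>v 2 \<cdot>\<^sub>v ones (n - 1)) in
     four_block_mat
       (0\<^sub>m 1 1) r
       r\<^sup>T       (four_block_mat
                  (2 \<cdot>\<^sub>m (J_mat (n - 1) - 1\<^sub>m (n - 1))) (S_mat n)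
                  (S_mat n)\<^sup>T                          (T_mat n)))"

definition omega :: "nat \<Rightarrow> complex" where
  "omega n = exp (2 * complex_of_real pi * \<i> / (of_nat n - 1))"

definition theta :: "nat \<Rightarrow> nat \<Rightarrow> real" where
  "theta n k = - 8 * (cos (pi * real k / (real n - 1)))\<^sup>2 - 2"

definition alpha :: "nat \<Rightarrow> nat \<Rightarrow> real" where
  "alpha n j =
    (15 - 5 * real n - 2 * (-1) ^ j * sqrt 5 * sqrt (real n * (2 * real n - 9) + 12))
      / (3 * (real n - 1))"

definition beta :: "nat \<Rightarrow> nat \<Rightarrow> real" where
  "beta n j =
    (6 - real n - (-1) ^ j * sqrt 5 * sqrt (real n * (2 * real n - 9) + 12))
      / (3 * (real n - 1))"

definition x_vec :: "nat \<Rightarrow> nat \<Rightarrow> complex vec" where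
  "x_vec n j =
    vec 1 (\<lambda>_. complex_of_real (alpha n j))
      @\<^sub>v complex_of_real (beta n j) \<cdot>\<^sub>v ones (n - 1)
      @\<^sub>v ones (n - 1)"

definition v_vec :: "nat \<Rightarrow> nat \<Rightarrow> complex vec" where
  "v_vec n k = vec (n - 1) (\<lambda>i. omega n ^ (i * k))"

definition u_vec :: "nat \<Rightarrow> nat \<Rightarrow> complex vec" where
  "u_vec n k =
    complex_of_real (- 1 / (8 * (cos (pi * real k / (real n - 1)))\<^sup>2))
      \<cdot>\<^sub>v (S_mat n *\<^sub>v v_vec n k)"

definition q_vec :: "nat \<Rightarrow> nat \<Rightarrow> complex vec" where
  "q_vec n k = 0\<^sub>v 1 @\<^sub>v u_vec n k @\<^sub>v v_vec n k"

end

theory Submission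
  imports Defs
begin

text \<open>
  For an \<open>m\<close>-th root of unity \<open>w\<close>, the vector \<open>(1, w, w\<^sup>2, \<dots>)\<close> is an eigenvector of every
  circulant of size \<open>m\<close>. With \<open>m = n - 1\<close> and \<open>w = \<omega>\<^sup>k \<noteq> 1\<close> the eigenvalues of
  \<open>S\<close>, \<open>S'\<close>, \<open>T\<close> and \<open>J\<close> are \<open>- 2 (1 + w\<^sup>-\<^sup>1)\<close>, \<open>- 2 (1 + w)\<close>, \<open>- 2 c\<close> and \<open>0\<close>, where
  \<open>c = (1 + w) (1 + w\<^sup>-\<^sup>1) = 4 cos\<^sup>2 (\<pi> k / m)\<close> is nonzero because \<open>m\<close> is odd.
  The eigenvector equation is then a scalar identity, and all orthogonality relations reduce
  to that of the Fourier vectors for distinct roots of unity.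
\<close>

section \<open>Fourier vectors as eigenvectors of circulant matrices\<close>

definition powers_vec :: "nat \<Rightarrow> 'a :: monoid_mult \<Rightarrow> 'a vec" where
  "powers_vec m w = vec m (\<lambda>i. w ^ i)"

lemma dim_powers_vec [simp]: "dim_vec (powers_vec m w) = m"
  by (simp add: powers_vec_def)

lemma powers_vec_carrier [simp]: "powers_vec m w \<in> carrier_vec m"
  by (simp add: powers_vec_def)

lemma index_powers_vec [simp]: "i < m \<Longrightarrow> powers_vec m w $ i = w ^ i"
  by (simp add: powers_vec_def)

lemma sum_powers_root_of_unity:
  fixes w :: "'a :: field"
  assumes "w ^ m = 1" "w \<noteq> 1"
  shows "(\<Sum>i<m. w ^ i) = 0"
  using assms by (simp add: geometric_sum)

lemma power_mod_root_of_unity: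
  fixes w :: "'a :: monoid_mult"
  assumes "w ^ m = 1"
  shows "w ^ (i mod m) = w ^ i"
proof -
  have "w ^ i = w ^ (m * (i div m) + i mod m)" by simp
  also have "\<dots> = w ^ (i mod m)" by (simp only: power_add power_mult assms power_one mult_1_left)
  finally show ?thesis ..
qed

text \<open>Row \<open>i\<close> is the first row shifted by \<open>i\<close>, so the substitution c
  = j - i mod m pulls out the factor \<open>w ^ i\<close>; exponents may be reduced mod
  \<open>m\<close> because \<open>w ^ m = 1\<close>.\<close>

lemma Circ_mult_powers_vec:
  fixes w :: "'a :: field"
  assumes a: "length a = m" and w: "w ^ m = 1"
  shows "Circ a *\<^sub>v powers_vec m w = (\<Sum>c<m. a ! c * w ^ c) \<cdot>\<^sub>v powers_vec m w"
proof (rule eq_vecI)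
  fix i assume "i < dim_vec ((\<Sum>c<m. a ! c * w ^ c) \<cdot>\<^sub>v powers_vec m w)"
  then have i: "i < m" by simp
  have "(Circ a *\<^sub>v powers_vec m w) $ i = (\<Sum>j<m. a ! ((j + m - i) mod m) * w ^ j)"
    using i a by (auto simp: Circ_def scalar_prod_def atLeast0LessThan intro!: sum.cong)
  also have "\<dots> = (\<Sum>c<m. w ^ i * (a ! c * w ^ c))"
  \<comment> \<open>The summand \<open>+ m\<close> keeps the natural-number subtraction from
    truncating.\<close>
  proof (rule sum.reindex_bij_witness[of _ "\<lambda>c. (c + i) mod m" "\<lambda>j. (j + m - i) mod m"])
    fix j assume "j \<in> {..<m}"
    then have j: "j < m" by simp
    show "((j + m - i) mod m + i) mod m = j"
      using i j by (simp add: mod_add_left_eq)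
    have "w ^ i * w ^ ((j + m - i) mod m) = w ^ (i + (j + m - i))"
      by (simp add: power_mod_root_of_unity[OF w] power_add)
    also have "i + (j + m - i) = j + m" using i by simp
    finally show "w ^ i * (a ! ((j + m - i) mod m) * w ^ ((j + m - i) mod m))
        = a ! ((j + m - i) mod m) * w ^ j"
      by (simp add: power_add w mult_ac)
  next
    fix c assume c: "c \<in> {..<m}"
    show "((c + i) mod m + m - i) mod m = c"
      using i c by (cases "c + i < m") (auto simp: mod_if)
  qed (use i in auto)
  finally show "(Circ a *\<^sub>v powers_vec m w) $ i = ((\<Sum>c<m. a ! c * w ^ c) \<cdot>\<^sub>v powers_vec m w) $ i"
    using i by (simp add: sum_distrib_left mult.commute)
qed (simp add: Circ_def a)

text \<open>Transposition reverses the shift: now c = i - j mod m, so \<open>w ^ j\<close> becomes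
  \<open>w ^ i * inverse w ^ c\<close>, which puts \<open>inverse w\<close> into the
  eigenvalue.\<close>

lemma transpose_Circ_mult_powers_vec:
  fixes w :: "'a :: field"
  assumes a: "length a = m" and w: "w ^ m = 1"
  shows "(Circ a)\<^sup>T *\<^sub>v powers_vec m w = (\<Sum>c<m. a ! c * inverse w ^ c) \<cdot>\<^sub>v powers_vec m w"
proof (rule eq_vecI)
  fix i assume "i < dim_vec ((\<Sum>c<m. a ! c * inverse w ^ c) \<cdot>\<^sub>v powers_vec m w)"
  then have i: "i < m" by simp
  have w0: "w \<noteq> 0" using w i by (auto simp: power_0_left split: if_splits)
  have "((Circ a)\<^sup>T *\<^sub>v powers_vec m w) $ i = (\<Sum>j<m. a ! ((i + m - j) mod m) * w ^ j)"
    using i a by (auto simp: Circ_def scalar_prod_def atLeast0LessThan intro!: sum.cong)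
  also have "\<dots> = (\<Sum>c<m. w ^ i * (a ! c * inverse w ^ c))"
  \<comment> \<open>The map sending j to i - j mod m is an involution, hence serves as its own
    inverse.\<close>
  proof (rule sum.reindex_bij_witness[of _ "\<lambda>c. (i + m - c) mod m" "\<lambda>j. (i + m - j) mod m"])
    have invol: "(i + m - (i + m - j) mod m) mod m = j" if "j < m" for j
      using i that by (cases "j \<le> i") (auto simp: mod_if)
    show "(i + m - (i + m - j) mod m) mod m = j" if "j \<in> {..<m}" for j
      using invol that by simp
    show "(i + m - (i + m - j) mod m) mod m = j" if "j \<in> {..<m}" for j
      using invol that by simp
    fix j assume "j \<in> {..<m}"
    then have j: "j < m" by simp
    have "w ^ j * w ^ (i + m - j) = w ^ (i + m)"
      using j by (simp flip: power_add)
    also have "\<dots> = w ^ i" by (simp add: power_add w)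
    finally have "w ^ j * w ^ (i + m - j) = w ^ i" .
    then have "w ^ i * inverse w ^ ((i + m - j) mod m) = w ^ j"
      using w0 by (simp add: power_mod_root_of_unity[OF w] power_inverse field_simps)
    then show "w ^ i * (a ! ((i + m - j) mod m) * inverse w ^ ((i + m - j) mod m))
        = a ! ((i + m - j) mod m) * w ^ j"
      by (simp add: mult_ac)
  qed (use i in auto)
  finally show "((Circ a)\<^sup>T *\<^sub>v powers_vec m w) $ i
      = ((\<Sum>c<m. a ! c * inverse w ^ c) \<cdot>\<^sub>v powers_vec m w) $ i"
    using i by (simp add: sum_distrib_left mult.commute)
qed (simp add: Circ_def a)

section \<open>Eigenvalues of the four blocks\<close>

lemma S_symbol:
  fixes w :: complex
  assumes n: "n \<ge> 4" and w: "w ^ (n - 1) = 1" "w \<noteq> 1"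
  shows "(\<Sum>c<n - 1. ([1] @ replicate (n - 3) 3 @ [1]) ! c * w ^ c) = - 2 * (1 + inverse w)"
proof -
  obtain p where p: "n = p + 4" using n by (metis add.commute le_Suc_ex)
  \<comment> \<open>The last index of the first row is \<open>p + 2\<close>, that is n - 2, so its
    power of \<open>w\<close> is \<open>inverse w\<close>.\<close>
  have "w * w ^ (p + 2) = 1" using w p by (simp add: power_add eval_nat_numeral)
  then have last: "w ^ (p + 2) = inverse w" by (metis inverse_unique)
  \<comment> \<open>The row is the constant 3 lowered by 2 at both ends; the constant part sums to
    zero over the powers of \<open>w\<close>.\<close>
  have "(\<Sum>c<n - 1. ([1] @ replicate (n - 3) 3 @ [1]) ! c * w ^ c)
      = (\<Sum>c<n - 1. 3 * w ^ c - (if c = 0 then 2 else 0) - (if c = p + 2 then 2 * w ^ (p + 2) else 0))"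
    using p by (intro sum.cong) (auto simp: nth_Cons nth_append split: nat.split)
  also have "\<dots> = 3 * (\<Sum>c<n - 1. w ^ c) - 2 - 2 * w ^ (p + 2)"
    using p by (simp add: sum_subtractf sum_distrib_left sum.delta)
  also have "\<dots> = - 2 * (1 + inverse w)"
    by (simp only: sum_powers_root_of_unity[OF w] last) simp
  finally show ?thesis .
qed

lemma T_symbol:
  fixes w :: complex
  assumes n: "n \<ge> 4" and w: "w ^ (n - 1) = 1" "w \<noteq> 1"
  shows "(\<Sum>c<n - 1. ([0, 2] @ replicate (n - 4) 4 @ [2]) ! c * w ^ c)
    = - 2 * ((1 + w) * (1 + inverse w))"
proof -
  obtain p where p: "n = p + 4" using n by (metis add.commute le_Suc_ex)
  have w1: "w * w ^ (p + 2) = 1" using w p by (simp add: power_add eval_nat_numeral)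
  then have last: "w ^ (p + 2) = inverse w" by (metis inverse_unique)
  have w0: "w \<noteq> 0" using w1 by auto
  \<comment> \<open>Constant 4 lowered by 4, 2 and 2 at the indices 0, 1 and \<open>p + 2\<close>,
    which are distinct even for n = 4.\<close>
  have "(\<Sum>c<n - 1. ([0, 2] @ replicate (n - 4) 4 @ [2]) ! c * w ^ c)
      = (\<Sum>c<n - 1. 4 * w ^ c - (if c = 0 then 4 else 0) - (if c = 1 then 2 * w else 0)
          - (if c = p + 2 then 2 * w ^ (p + 2) else 0))"
    using p by (intro sum.cong) (auto simp: nth_Cons nth_append split: nat.split)
  also have "\<dots> = 4 * (\<Sum>c<n - 1. w ^ c) - 4 - 2 * w - 2 * w ^ (p + 2)"
    using p by (simp add: sum_subtractf sum_distrib_left sum.delta)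
  also have "\<dots> = - 2 * ((1 + w) * (1 + inverse w))"
    using w0 by (simp only: sum_powers_root_of_unity[OF w] last) (simp add: field_simps)
  finally show ?thesis .
qed

lemma S_mat_carrier: "n \<ge> 4 \<Longrightarrow> S_mat n \<in> carrier_mat (n - 1) (n - 1)"
  by (auto simp: S_mat_def Circ_def)

lemma T_mat_carrier: "n \<ge> 4 \<Longrightarrow> T_mat n \<in> carrier_mat (n - 1) (n - 1)"
  by (auto simp: T_mat_def Circ_def)

lemma S_mat_mult_powers_vec:
  assumes "n \<ge> 4" "w ^ (n - 1) = 1" "w \<noteq> 1"
  shows "S_mat n *\<^sub>v powers_vec (n - 1) w = (- 2 * (1 + inverse w)) \<cdot>\<^sub>v powers_vec (n - 1) w"
  unfolding S_mat_def S_symbol[OF assms, symmetric]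
  using assms by (intro Circ_mult_powers_vec) auto

text \<open>\<open>inverse w\<close> is again a root of unity other than 1, so
  \<open>S_symbol\<close> applies to it.\<close>

lemma transpose_S_mat_mult_powers_vec:
  assumes "n \<ge> 4" "w ^ (n - 1) = 1" "w \<noteq> 1"
  shows "(S_mat n)\<^sup>T *\<^sub>v powers_vec (n - 1) w = (- 2 * (1 + w)) \<cdot>\<^sub>v powers_vec (n - 1) w"
proof -
  have "inverse w ^ (n - 1) = 1" "inverse w \<noteq> 1"
    using assms by (auto simp: power_inverse)
  from S_symbol[OF assms(1) this]
  show ?thesis
    unfolding S_mat_def using assms by (subst transpose_Circ_mult_powers_vec) auto
qed

lemma T_mat_mult_powers_vec:
  assumes "n \<ge> 4" "w ^ (n - 1) = 1" "w \<noteq> 1"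
  shows "T_mat n *\<^sub>v powers_vec (n - 1) w
    = (- 2 * ((1 + w) * (1 + inverse w))) \<cdot>\<^sub>v powers_vec (n - 1) w"
  unfolding T_mat_def T_symbol[OF assms, symmetric]
  using assms by (intro Circ_mult_powers_vec) auto

lemma J_mat_eq: "J_mat p = mat p p (\<lambda>_. 1)"
  by (rule eq_matI) (auto simp: J_mat_def ones_def mat_of_row_def scalar_prod_def)

text \<open>The entries of the Fourier vector sum to zero, so \<open>J_mat m\<close> annihilates it
  and only -2 times the identity acts.\<close>

lemma J_minus_one_mult_powers_vec:
  assumes "w ^ m = 1" "w \<noteq> 1"
  shows "2 \<cdot>\<^sub>m (J_mat m - 1\<^sub>m m) *\<^sub>v powers_vec m w = (- 2) \<cdot>\<^sub>v powers_vec m w"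
proof (rule eq_vecI)
  fix i assume "i < dim_vec ((- 2) \<cdot>\<^sub>v powers_vec m w)"
  then have i: "i < m" by simp
  have "(2 \<cdot>\<^sub>m (J_mat m - 1\<^sub>m m) *\<^sub>v powers_vec m w) $ i
      = (\<Sum>j<m. 2 * w ^ j - (if j = i then 2 * w ^ i else 0))"
    using i by (auto simp: J_mat_eq scalar_prod_def atLeast0LessThan intro!: sum.cong)
  also have "\<dots> = 2 * (\<Sum>j<m. w ^ j) - 2 * w ^ i"
    using i by (simp add: sum_subtractf sum_distrib_left)
  finally show "(2 \<cdot>\<^sub>m (J_mat m - 1\<^sub>m m) *\<^sub>v powers_vec m w) $ i = ((- 2) \<cdot>\<^sub>v powers_vec m w) $ i"
    using i by (simp add: sum_powers_root_of_unity[OF assms])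
qed (simp add: J_mat_eq)

section \<open>The roots of unity \<open>omega n ^ k\<close> and the vectors built from them\<close>

lemma omega_power:
  assumes "n \<ge> 4"
  shows "omega n ^ k = cis (2 * pi * real k / real (n - 1))"
proof -
  have "omega n = cis (2 * pi / real (n - 1))"
    using assms by (simp add: omega_def cis_conv_exp of_nat_diff mult_ac)
  then show ?thesis by (simp add: DeMoivre mult_ac)
qed

lemma omega_power_root_of_unity: "n \<ge> 4 \<Longrightarrow> (omega n ^ k) ^ (n - 1) = 1"
  by (simp add: omega_power DeMoivre)

lemma omega_power_inj:
  assumes "n \<ge> 4" "k < n - 1" "l < n - 1" "omega n ^ k = omega n ^ l"
  shows "k = l"
proof -
  have "inj_on (\<lambda>k. cis (2 * pi * real k / real (n - 1))) {..<n - 1}"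
    using bij_betw_roots_unity[of "n - 1"] assms(1) by (auto simp: bij_betw_def)
  then show ?thesis using assms by (auto simp: omega_power inj_on_def)
qed

lemma omega_power_ne_1:
  assumes "n \<ge> 4" "k \<in> {1..n - 2}"
  shows "omega n ^ k \<noteq> 1"
proof
  assume "omega n ^ k = 1"
  moreover have "k < n - 1" "0 < n - 1" using assms by auto
  ultimately show False using omega_power_inj[of n k 0] assms by simp
qed

lemma v_vec_eq: "v_vec n k = powers_vec (n - 1) (omega n ^ k)"
  by (auto simp: v_vec_def powers_vec_def power_mult[symmetric] mult.commute)

text \<open>Links the cosines in \<open>theta\<close> and \<open>u_vec\<close> to the eigenvalues of
  the blocks: with w = exp(2ix) the product is 2 + 2 cos 2x, and the double-angle formula
  finishes.\<close>

lemma four_cos_squared_eq: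
  assumes "n \<ge> 4"
  shows "complex_of_real (4 * (cos (pi * real k / (real n - 1)))\<^sup>2)
    = (1 + omega n ^ k) * (1 + inverse (omega n ^ k))"
proof -
  define x where "x = pi * real k / (real n - 1)"
  have w: "omega n ^ k = cis (2 * x)"
    using assms by (simp add: omega_power x_def of_nat_diff mult_ac)
  have "(1 + cis (2 * x)) * (1 + inverse (cis (2 * x))) = 2 + (cis (2 * x) + cis (- (2 * x)))"
    by (simp add: cis_inverse algebra_simps cis_mult)
  also have "\<dots> = complex_of_real (2 + 2 * cos (2 * x))"
    by (simp add: complex_eq_iff)
  also have "2 + 2 * cos (2 * x) = 4 * (cos x)\<^sup>2"
    by (simp add: cos_double_cos)
  finally show ?thesis by (simp add: w x_def)
qed

text \<open>Here parity enters: n - 1 is odd, so -1 is not an (n-1)-th root of unity. This keeps the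
  denominator in \<open>u_vec\<close> away from zero.\<close>

lemma one_plus_omega_power_ne_0:
  assumes "n \<ge> 4" "even n"
  shows "1 + omega n ^ k \<noteq> 0"
proof
  assume "1 + omega n ^ k = 0"
  then have "omega n ^ k = - 1" by (simp add: add_eq_0_iff)
  with omega_power_root_of_unity[of n k] assms show False by simp
qed

text \<open>The eigenvalue of \<open>S_mat n\<close> contributes -2 (1 + 1/w), and the factor 1 +
  1/w cancels against the cosine denominator. Both long blocks of \<open>q_vec n k\<close> are thus
  multiples of one Fourier vector.\<close>

lemma u_vec_eq:
  assumes "n \<ge> 4" "even n" "k \<in> {1..n - 2}"
  shows "u_vec n k = inverse (1 + omega n ^ k) \<cdot>\<^sub>v powers_vec (n - 1) (omega n ^ k)"
proof -
  define w where "w = omega n ^ k"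
  have w: "w ^ (n - 1) = 1" "w \<noteq> 1" "1 + w \<noteq> 0"
    using assms omega_power_root_of_unity omega_power_ne_1 one_plus_omega_power_ne_0
    by (auto simp: w_def)
  have w0: "w \<noteq> 0" using w assms by (auto simp: power_0_left)
  have "complex_of_real (- 1 / (8 * (cos (pi * real k / (real n - 1)))\<^sup>2))
      = - 1 / (2 * complex_of_real (4 * (cos (pi * real k / (real n - 1)))\<^sup>2))"
    by simp
  also have "\<dots> = - 1 / (2 * ((1 + w) * (1 + inverse w)))"
    unfolding w_def by (simp only: four_cos_squared_eq[OF assms(1)])
  finally have "u_vec n k = (- 1 / (2 * ((1 + w) * (1 + inverse w))) * (- 2 * (1 + inverse w)))
      \<cdot>\<^sub>v powers_vec (n - 1) w"
    unfolding u_vec_def v_vec_eq w_def[symmetric] S_mat_mult_powers_vec[OF assms(1) w(1,2)]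
    by (simp only: smult_smult_assoc)
  also have "- 1 / (2 * ((1 + w) * (1 + inverse w))) * (- 2 * (1 + inverse w)) = inverse (1 + w)"
  proof -
    have "1 + inverse w \<noteq> 0" using w0 w(3) by (simp add: field_simps add.commute)
    then show ?thesis using w(3) by (simp add: divide_simps)
  qed
  finally show ?thesis by (simp add: w_def)
qed

section \<open>The eigenvector equation\<close>

lemma smult_append_vec: "a \<cdot>\<^sub>v (x @\<^sub>v y) = a \<cdot>\<^sub>v x @\<^sub>v a \<cdot>\<^sub>v y"
  by (rule eq_vecI) (auto simp: append_vec_def Let_def)

lemma conjugate_append_vec: "conjugate (x @\<^sub>v y) = conjugate x @\<^sub>v conjugate y"
  by (rule eq_vecI) (auto simp: append_vec_def Let_def)

text \<open>On the common eigenvector \<open>P\<close> the lower right part of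
  \<open>D_mat n\<close> acts as the 2x2 matrix with rows (-2, -2(1 + 1/w)) and (-2(1 + w), -2c).
  Its determinant is 0, so its trace -2c - 2 is an eigenvalue, with eigenvector (b, 1).\<close>

lemma D_mat_mult_q_vec:
  assumes n: "n \<ge> 4" "even n" and k: "k \<in> {1..n - 2}"
  shows "D_mat n *\<^sub>v q_vec n k = complex_of_real (theta n k) \<cdot>\<^sub>v q_vec n k"
proof -
  define m w where "m = n - 1" and "w = omega n ^ k"
  define P where "P = powers_vec m w"
  define b where "b = inverse (1 + w)"
  define r where "r = mat_of_row (ones m @\<^sub>v 2 \<cdot>\<^sub>v ones m)"
  define c where "c = (1 + w) * (1 + inverse w)"
  have w: "w ^ m = 1" "w \<noteq> 1" "1 + w \<noteq> 0"
    using n k omega_power_root_of_unity omega_power_ne_1 one_plus_omega_power_ne_0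
    by (auto simp: w_def m_def)
  have P: "P \<in> carrier_vec m" by (simp add: P_def)
  have bP: "b \<cdot>\<^sub>v P \<in> carrier_vec m" using P by simp
  have q: "q_vec n k = 0\<^sub>v 1 @\<^sub>v b \<cdot>\<^sub>v P @\<^sub>v P"
    using u_vec_eq[OF n k] by (simp add: q_vec_def v_vec_eq P_def b_def m_def w_def)
  have theta: "complex_of_real (theta n k) = - 2 * c - 2"
    using four_cos_squared_eq[OF n(1), of k] by (simp add: theta_def c_def w_def)
  have S: "S_mat n \<in> carrier_mat m m" and T: "T_mat n \<in> carrier_mat m m"
    and J: "2 \<cdot>\<^sub>m (J_mat m - 1\<^sub>m m) \<in> carrier_mat m m"
    using S_mat_carrier T_mat_carrier n by (auto simp: m_def J_mat_eq)
  have r: "r \<in> carrier_mat 1 (m + m)"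
    by (auto simp: r_def ones_def)
  define B where "B = four_block_mat (2 \<cdot>\<^sub>m (J_mat m - 1\<^sub>m m)) (S_mat n) (S_mat n)\<^sup>T (T_mat n)"
  have B: "B \<in> carrier_mat (m + m) (m + m)"
    unfolding B_def using J T by simp
  \<comment> \<open>The border row is constant on each block, so it annihilates the tail of
    \<open>q_vec n k\<close>.\<close>
  have "ones m \<bullet> P = 0"
    using sum_powers_root_of_unity[OF w(1,2)]
    by (simp add: ones_def P_def scalar_prod_def atLeast0LessThan)
  moreover have "ones m \<in> carrier_vec m" by (simp add: ones_def)
  ultimately have "(ones m @\<^sub>v 2 \<cdot>\<^sub>v ones m) \<bullet> (b \<cdot>\<^sub>v P @\<^sub>v P) = 0"
    using P by (simp add: scalar_prod_append[of _ m _ m])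
  then have "r *\<^sub>v (b \<cdot>\<^sub>v P @\<^sub>v P) = 0\<^sub>v 1"
    by (intro eq_vecI) (auto simp: r_def)
  moreover have "B *\<^sub>v (b \<cdot>\<^sub>v P @\<^sub>v P) = (- 2 * c - 2) \<cdot>\<^sub>v (b \<cdot>\<^sub>v P @\<^sub>v P)"
  proof -
    have "B *\<^sub>v (b \<cdot>\<^sub>v P @\<^sub>v P) =
        (2 \<cdot>\<^sub>m (J_mat m - 1\<^sub>m m) *\<^sub>v (b \<cdot>\<^sub>v P) + S_mat n *\<^sub>v P)
        @\<^sub>v ((S_mat n)\<^sup>T *\<^sub>v (b \<cdot>\<^sub>v P) + T_mat n *\<^sub>v P)"
      unfolding B_def using J S T bP P by (intro four_block_mat_mult_vec) auto
    also have "2 \<cdot>\<^sub>m (J_mat m - 1\<^sub>m m) *\<^sub>v (b \<cdot>\<^sub>v P) + S_mat n *\<^sub>v P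
        = (- 2 * c - 2) \<cdot>\<^sub>v (b \<cdot>\<^sub>v P)"
    proof -
      \<comment> \<open>This amounts to c b = 1 + 1/w.\<close>
      have "b * - 2 + - 2 * (1 + inverse w) = (- 2 * c - 2) * b"
        using w(3) by (simp add: b_def c_def field_simps)
      moreover have "2 \<cdot>\<^sub>m (J_mat m - 1\<^sub>m m) *\<^sub>v (b \<cdot>\<^sub>v P) = (b * - 2) \<cdot>\<^sub>v P"
        using J_minus_one_mult_powers_vec[OF w(1,2)] mult_mat_vec[OF J P]
        by (simp add: P_def smult_smult_assoc)
      moreover have "S_mat n *\<^sub>v P = (- 2 * (1 + inverse w)) \<cdot>\<^sub>v P"
        using S_mat_mult_powers_vec[OF n(1), folded m_def, OF w(1,2)] by (simp only: P_def)
      ultimately show ?thesis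
        by (simp only: smult_smult_assoc flip: add_smult_distrib_vec)
    qed
    also have "(S_mat n)\<^sup>T *\<^sub>v (b \<cdot>\<^sub>v P) + T_mat n *\<^sub>v P = (- 2 * c - 2) \<cdot>\<^sub>v P"
    proof -
      \<comment> \<open>This amounts to b (1 + w) = 1.\<close>
      have "b * (- 2 * (1 + w)) + - 2 * c = - 2 * c - 2"
        using w(3) by (simp add: b_def field_simps)
      moreover have "(S_mat n)\<^sup>T *\<^sub>v (b \<cdot>\<^sub>v P) = (b * (- 2 * (1 + w))) \<cdot>\<^sub>v P"
        using transpose_S_mat_mult_powers_vec[OF n(1), folded m_def, OF w(1,2)]
          mult_mat_vec[of "(S_mat n)\<^sup>T" m m P b] S P
        by (simp add: P_def smult_smult_assoc)
      moreover have "T_mat n *\<^sub>v P = (- 2 * c) \<cdot>\<^sub>v P"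
        using T_mat_mult_powers_vec[OF n(1), folded m_def, OF w(1,2)] by (simp only: P_def c_def)
      ultimately show ?thesis
        by (simp only: flip: add_smult_distrib_vec)
    qed
    finally show ?thesis by (simp only: smult_append_vec)
  qed
  \<comment> \<open>Splitting off the first coordinate leaves only \<open>B\<close> acting:
    \<open>r\<close> gives 0 on the tail, and the leading 0 of \<open>q_vec n k\<close> removes the
    border column.\<close>
  moreover have "D_mat n *\<^sub>v q_vec n k =
      (0\<^sub>m 1 1 *\<^sub>v 0\<^sub>v 1 + r *\<^sub>v (b \<cdot>\<^sub>v P @\<^sub>v P)) @\<^sub>v (r\<^sup>T *\<^sub>v 0\<^sub>v 1 + B *\<^sub>v (b \<cdot>\<^sub>v P @\<^sub>v P))"
    unfolding q D_mat_def Let_def m_def[symmetric] r_def[symmetric] B_def[symmetric]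
    using r B bP P by (intro four_block_mat_mult_vec) auto
  moreover have "r\<^sup>T *\<^sub>v 0\<^sub>v 1 = 0\<^sub>v (m + m)" "0\<^sub>m 1 1 *\<^sub>v 0\<^sub>v 1 = (0\<^sub>v 1 :: complex vec)"
    using r by (auto simp: scalar_prod_def)
  moreover have "(- 2 * c - 2) \<cdot>\<^sub>v (b \<cdot>\<^sub>v P @\<^sub>v P) \<in> carrier_vec (m + m)"
    using P by simp
  moreover have "(- 2 * c - 2) \<cdot>\<^sub>v 0\<^sub>v 1 = 0\<^sub>v 1"
    by (rule eq_vecI) auto
  ultimately show ?thesis
    unfolding theta q by (simp add: smult_append_vec del: smult_carrier_vec)
qed

section \<open>Orthogonality\<close>

lemma powers_vec_conjugate_orthogonal:
  assumes "w ^ m = 1" "z ^ m = 1" "cmod z = 1" "w \<noteq> z"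
  shows "powers_vec m w \<bullet>c powers_vec m z = 0"
proof -
  have z: "z * cnj z = 1" using assms(3) by (simp flip: complex_norm_square)
  \<comment> \<open>The inner product is the geometric sum of \<open>w * cnj z\<close>. As
    \<open>cnj z\<close> is the inverse of \<open>z\<close>, this is an \<open>m\<close>-th root of
    unity, and it differs from 1 because \<open>w \<noteq> z\<close>.\<close>
  have "(w * cnj z) ^ m = 1"
    using assms(1,2) by (simp add: power_mult_distrib flip: complex_cnj_power)
  moreover have "w * cnj z \<noteq> 1"
  proof
    assume "w * cnj z = 1"
    then have "w * (z * cnj z) = z" by (simp add: mult_ac)
    with z assms(4) show False by simp
  qed
  ultimately have "(\<Sum>i<m. (w * cnj z) ^ i) = 0" by (rule sum_powers_root_of_unity)
  then show ?thesis
    by (simp add: scalar_prod_def atLeast0LessThan power_mult_distrib conjugate_complex_def)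
qed

text \<open>Common form of all three orthogonality claims: the leading 0 on the right cancels
  \<open>h\<close>, and both remaining block products are multiples of
  \<open>x \<bullet>c y\<close>.\<close>

lemma blocks_conjugate_orthogonal:
  fixes x y :: "complex vec"
  assumes "x \<in> carrier_vec m" "y \<in> carrier_vec m" "x \<bullet>c y = 0" "h \<in> carrier_vec 1"
  shows "(h @\<^sub>v a \<cdot>\<^sub>v x @\<^sub>v x) \<bullet>c (0\<^sub>v 1 @\<^sub>v b \<cdot>\<^sub>v y @\<^sub>v y) = 0"
proof -
  have "(h @\<^sub>v a \<cdot>\<^sub>v x @\<^sub>v x) \<bullet>c (0\<^sub>v 1 @\<^sub>v b \<cdot>\<^sub>v y @\<^sub>v y)
      = h \<bullet> 0\<^sub>v 1 + ((a \<cdot>\<^sub>v x) \<bullet>c (b \<cdot>\<^sub>v y) + x \<bullet>c y)"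
    using assms
    by (simp add: conjugate_append_vec scalar_prod_append[of _ 1 _ "m + m"]
        scalar_prod_append[of _ m _ m])
  then show ?thesis using assms by (simp add: conjugate_smult_vec)
qed

theorem theorem2:
  fixes n :: nat
  assumes "n \<ge> 4" and "even n"
  shows "(\<forall>k\<in>{1..n - 2}. D_mat n *\<^sub>v q_vec n k = complex_of_real (theta n k) \<cdot>\<^sub>v q_vec n k) \<and>
    (\<forall>k\<in>{1..n - 2}. \<forall>l\<in>{1..n - 2}. k \<noteq> l \<longrightarrow> q_vec n k \<bullet>c q_vec n l = 0) \<and>
    (\<forall>j\<in>{1, 2}. \<forall>k\<in>{1..n - 2}. x_vec n j \<bullet>c q_vec n k = 0) \<and>
    (\<forall>k\<in>{1..n - 2}. ones (2 * n - 1) \<bullet>c q_vec n k = 0)"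
proof -
  let ?P = "\<lambda>k. powers_vec (n - 1) (omega n ^ k)"
  have q: "q_vec n k = 0\<^sub>v 1 @\<^sub>v inverse (1 + omega n ^ k) \<cdot>\<^sub>v ?P k @\<^sub>v ?P k" if "k \<in> {1..n - 2}" for k
    using u_vec_eq[OF assms that] by (simp add: q_vec_def v_vec_eq)
  \<comment> \<open>The index 0 is included on purpose: \<open>?P 0\<close> is the all-ones vector,
    so this also covers \<open>x_vec\<close> and \<open>ones\<close>.\<close>
  have orth: "?P k \<bullet>c ?P l = 0" if "k < n - 1" "l < n - 1" "k \<noteq> l" for k l
    using that assms omega_power_inj[of n k l]
    by (intro powers_vec_conjugate_orthogonal omega_power_root_of_unity) (auto simp: omega_power)
  have ones: "ones (n - 1) = ?P 0"
    by (simp add: ones_def powers_vec_def)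
  have x: "x_vec n j = vec 1 (\<lambda>_. complex_of_real (alpha n j))
      @\<^sub>v complex_of_real (beta n j) \<cdot>\<^sub>v ?P 0 @\<^sub>v ?P 0" for j
    unfolding x_vec_def ones ..
  \<comment> \<open>The lengths match as 2n - 1 = 1 + (n - 1) + (n - 1); the scalar 1 produces the
    shape that \<open>blocks_conjugate_orthogonal\<close> expects.\<close>
  have "ones (2 * n - 1) = ones 1 @\<^sub>v 1 \<cdot>\<^sub>v ones (n - 1) @\<^sub>v ones (n - 1)"
    using assms by (intro eq_vecI) (auto simp: ones_def append_vec_def Let_def)
  then have all_ones: "ones (2 * n - 1) = ones 1 @\<^sub>v 1 \<cdot>\<^sub>v ?P 0 @\<^sub>v ?P 0"
    by (simp only: ones)
  have h: "ones 1 \<in> carrier_vec 1" by (simp add: ones_def)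
  show ?thesis
  proof (intro conjI ballI impI)
    fix k l assume kl: "k \<in> {1..n - 2}" "l \<in> {1..n - 2}" "k \<noteq> l"
    then show "q_vec n k \<bullet>c q_vec n l = 0"
      unfolding q[OF kl(1)] q[OF kl(2)]
      by (intro blocks_conjugate_orthogonal[of _ "n - 1"] orth) auto
  next
    fix j k assume k: "k \<in> {1..n - 2}"
    then show "x_vec n j \<bullet>c q_vec n k = 0"
      unfolding q[OF k] x by (intro blocks_conjugate_orthogonal[of _ "n - 1"] orth) auto
  next
    fix k assume k: "k \<in> {1..n - 2}"
    then show "ones (2 * n - 1) \<bullet>c q_vec n k = 0"
      unfolding q[OF k] all_ones using h
      by (intro blocks_conjugate_orthogonal[of _ "n - 1"] orth) auto
  qed (rule D_mat_mult_q_vec[OF assms])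
qed

end
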